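(* Let $X$ be an infinite-dimensional separable Banach space over $\mathbb{K}\in\{\mathbb{R},\mathbb{C}\}$, and let $T, S \in \mathcal{B}(X)$ with $T = \lambda I + S$ for some $\lambda \in \mathbb{K}$. Suppose $T$ is hypercyclic. Then the following assertions are equivalent: (i) $T$ satisfies the Hypercyclicity Criterion; (ii) $T$ satisfies the Cyclicity Criterion; (iii) $S$ satisfies the Cyclicity Criterion; (iv) $S \oplus S$ is cyclic on $X \oplus X$; (v) $T \oplus T$ is cyclic on $X \oplus X$; (vi) $T \oplus T$ is hypercyclic on $X \oplus X$.
   Context: $\mathcal{B}(X)$ denotes the algebra of bounded linear operators on $X$. An operator $T \in \mathcal{B}(X)$ is hypercyclic if there is $x \in X$ with $\{T^n x : n \ge 0\}$ dense in $X$; it is cyclic if there is $x\in X$ with $\operatorname{span}\{T^n x : n\ge 0\}$ dense in $X$. $T\oplus T$ denotes the operator $(x,y)\mapsto (Tx,Ty)$ on $X\oplus X$. $T$ satisfies the Hypercyclicity Criterion if there exist dense subsets $X_0, Y_0 \subseteq X$, an increasing sequence $(n_k)_{k\ge1}$ of positive integers, and maps (not necessarily linear or continuous) $S_{n_k}: Y_0 \to X$ such that: $T^{n_k}x \to 0$ for every $x \in X_0$; $S_{n_k}y \to 0$ for every $y \in Y_0$; and $T^{n_k}S_{n_k}y \to y$ for every $y \in Y_0$. An operator $A\in\mathcal{B}(X)$ satisfies the Cyclicity Criterion if there exist dense subsets $V, W \subseteq X$, a sequence $(p_k)_{k\ge1}$ of polynomials in $\mathbb{K}[x]$, and maps (not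 necessarily linear or continuous) $S_k : W \to X$ such that: $p_k(A)x \to 0$ for every $x \in V$; $S_k x \to 0$ for every $x \in W$; and $p_k(A)S_k x \to x$ for every $x \in W$. *)

theory Defs
  imports "HOL-Analysis.Analysis" "HOL-Computational_Algebra.Polynomial"
begin

text \<open>Scalars are given by an explicit scalar multiplication sm :: 'k => 'a => 'a
  on a real normed (Banach) space 'a.  For K = R we take sm = scaleR; for K = C we
  take a complex scalar multiplication extending scaleR and compatible with the norm.\<close>

definition complex_scalar_mult :: "(complex \<Rightarrow> 'a::real_normed_vector \<Rightarrow> 'a) \<Rightarrow> bool" where
  "complex_scalar_mult cs \<longleftrightarrow>
     (\<forall>r x. cs (complex_of_real r) x = r *\<^sub>R x) \<and>
     (\<forall>a b x. cs (a * b) x = cs a (cs b x)) \<and>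
     (\<forall>a b x. cs (a + b) x = cs a x + cs b x) \<and>
     (\<forall>a x y. cs a (x + y) = cs a x + cs a y) \<and>
     (\<forall>a x. norm (cs a x) = cmod a * norm x)"

definition bop :: "('k \<Rightarrow> 'a::real_normed_vector \<Rightarrow> 'a) \<Rightarrow> ('a \<Rightarrow> 'a) \<Rightarrow> bool" where
  "bop sm A \<longleftrightarrow> bounded_linear A \<and> (\<forall>c x. A (sm c x) = sm c (A x))"

definition kspan :: "('k::field \<Rightarrow> 'a::real_vector \<Rightarrow> 'a) \<Rightarrow> 'a set \<Rightarrow> 'a set" where
  "kspan sm V = {\<Sum>v\<in>F. sm (c v) v | F c. finite F \<and> F \<subseteq> V}"

definition separable_space :: "'a::topological_space itself \<Rightarrow> bool" where
  "separable_space _ \<longleftrightarrow> (\<exists>D::'a set. countable D \<and> closure D = UNIV)"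

definition infinite_dimensional :: "('k::field \<Rightarrow> 'a::real_vector \<Rightarrow> 'a) \<Rightarrow> bool" where
  "infinite_dimensional sm \<longleftrightarrow> \<not> (\<exists>B. finite B \<and> kspan sm B = UNIV)"

definition hypercyclic :: "('a::topological_space \<Rightarrow> 'a) \<Rightarrow> bool" where
  "hypercyclic T \<longleftrightarrow> (\<exists>x. closure (range (\<lambda>n. (T ^^ n) x)) = UNIV)"

definition cyclic :: "('k::field \<Rightarrow> 'a::real_normed_vector \<Rightarrow> 'a) \<Rightarrow> ('a \<Rightarrow> 'a) \<Rightarrow> bool" where
  "cyclic sm T \<longleftrightarrow> (\<exists>x. closure (kspan sm (range (\<lambda>n. (T ^^ n) x))) = UNIV)"

definition hypercyclicity_criterion :: "('a::real_normed_vector \<Rightarrow> 'a) \<Rightarrow> bool" where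
  "hypercyclicity_criterion T \<longleftrightarrow>
     (\<exists>X0 Y0 (n::nat \<Rightarrow> nat) (S::nat \<Rightarrow> 'a \<Rightarrow> 'a).
        closure X0 = UNIV \<and> closure Y0 = UNIV \<and> strict_mono n \<and> (\<forall>k. 0 < n k) \<and>
        (\<forall>x\<in>X0. (\<lambda>k. (T ^^ n k) x) \<longlonglongrightarrow> 0) \<and>
        (\<forall>y\<in>Y0. (\<lambda>k. S k y) \<longlonglongrightarrow> 0) \<and>
        (\<forall>y\<in>Y0. (\<lambda>k. (T ^^ n k) (S k y)) \<longlonglongrightarrow> y))"

definition poly_op :: "('k::comm_ring_1 \<Rightarrow> 'a::real_vector \<Rightarrow> 'a) \<Rightarrow> 'k poly \<Rightarrow> ('a \<Rightarrow> 'a) \<Rightarrow> 'a \<Rightarrow> 'a" where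
  "poly_op sm p A x = (\<Sum>i\<le>degree p. sm (coeff p i) ((A ^^ i) x))"

definition cyclicity_criterion :: "('k::field \<Rightarrow> 'a::real_normed_vector \<Rightarrow> 'a) \<Rightarrow> ('a \<Rightarrow> 'a) \<Rightarrow> bool" where
  "cyclicity_criterion sm A \<longleftrightarrow>
     (\<exists>V W (p::nat \<Rightarrow> 'k poly) (S::nat \<Rightarrow> 'a \<Rightarrow> 'a).
        closure V = UNIV \<and> closure W = UNIV \<and>
        (\<forall>x\<in>V. (\<lambda>k. poly_op sm (p k) A x) \<longlonglongrightarrow> 0) \<and>
        (\<forall>x\<in>W. (\<lambda>k. S k x) \<longlonglongrightarrow> 0) \<and>
        (\<forall>x\<in>W. (\<lambda>k. poly_op sm (p k) A (S k x)) \<longlonglongrightarrow> x))"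

definition prod_smult :: "('k \<Rightarrow> 'a \<Rightarrow> 'a) \<Rightarrow> 'k \<Rightarrow> 'a \<times> 'a \<Rightarrow> 'a \<times> 'a" where
  "prod_smult sm c z = (sm c (fst z), sm c (snd z))"

definition dsum :: "('a \<Rightarrow> 'a) \<Rightarrow> 'a \<times> 'a \<Rightarrow> 'a \<times> 'a" where
  "dsum T z = (T (fst z), T (snd z))"

end

theory Submission
  imports Defs
begin

text \<open>
  The step with content is that a hypercyclic T with cyclic direct sum has a hypercyclic
  direct sum. Let (x, y) be cyclic for the direct sum and let U1, U2, V1, V2 be open.
  Choose polynomials p, q with (p(T) x, p(T) y) in U1 \<times> V1 and (q(T) x, q(T) y) in
  U2 \<times> V2. Transitivity of T gives x' near x and n with T^n x' near y. As polynomials in T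
  commute with T^n, the point (p(T) x', q(T) x') lies in U1 \<times> U2 and its n-th iterate in
  V1 \<times> V2, so the direct sum is transitive, hence hypercyclic by Baire.
  If (x, y) is hypercyclic for the direct sum, choose n_k with T^(n_k) x near 0 and
  T^(n_k) (y/k) near x; the orbit of x then witnesses the Hypercyclicity Criterion
  (Bes and Peris). Finally, the polynomials in T and in S form the same algebra, so
  statements about cyclicity pass between the two operators.
\<close>

section \<open>Transitive families of maps\<close>

lemma dense_meets_open:
  assumes "closure A = UNIV" "open U" "U \<noteq> {}"
  obtains a where "a \<in> A" "a \<in> U"
  using assms open_Int_closure_eq_empty[of U A] by auto

lemma denseI:
  assumes "\<And>U. open U \<Longrightarrow> U \<noteq> {} \<Longrightarrow> \<exists>a\<in>A. a \<in> U"
  shows "closure A = UNIV"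
proof (rule ccontr)
  assume "closure A \<noteq> UNIV"
  then obtain a where "a \<in> A" "a \<in> - closure A"
    using assms[of "- closure A"] by auto
  then show False
    using closure_subset by auto
qed

lemma separable_space_prod:
  assumes "separable_space TYPE('a::topological_space)"
  shows "separable_space TYPE('a \<times> 'a)"
proof -
  obtain D :: "'a set" where "countable D" "closure D = UNIV"
    using assms unfolding separable_space_def by auto
  then have "countable (D \<times> D)" "closure (D \<times> D) = UNIV"
    by (auto simp: closure_Times)
  then show ?thesis
    unfolding separable_space_def by blast
qed

text \<open>Birkhoff's transitivity argument. The points that some \<open>f i\<close> sends into a
  given ball around a point of \<open>D\<close> form an open set, dense by transitivity; Baire then
  yields a point common to these countably many sets. It serves both for the iterates of a direct
  sum and for a sequence of polynomials in it.\<close>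

lemma transitive_imp_universal:
  fixes f :: "'i \<Rightarrow> 'a::complete_space \<Rightarrow> 'b::metric_space"
  assumes sep: "separable_space TYPE('b)"
    and cont: "\<And>i. continuous_on UNIV (f i)"
    and trans: "\<And>U V. open U \<Longrightarrow> U \<noteq> {} \<Longrightarrow> open V \<Longrightarrow> V \<noteq> {} \<Longrightarrow> \<exists>i. \<exists>x\<in>U. f i x \<in> V"
  shows "\<exists>x. closure (range (\<lambda>i. f i x)) = UNIV"
proof -
  obtain D :: "'b set" where D: "countable D" "closure D = UNIV"
    using sep unfolding separable_space_def by auto
  define G where "G = (\<lambda>(d, n::nat). \<Union>i. f i -` ball d (inverse (Suc n)))"
  have "openin euclidean (G z) \<and> euclidean closure_of (G z) = topspace euclidean" for z
  proof -
    obtain d n where z: "z = (d, n)" by (cases z)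
    have "open (G z)"
      unfolding z G_def using cont by (auto intro!: open_UN open_vimage)
    moreover have "closure (G z) = UNIV"
    proof (rule denseI)
      fix U :: "'a set" assume "open U" "U \<noteq> {}"
      then show "\<exists>a\<in>G z. a \<in> U"
        using trans[of U "ball d (inverse (Suc n))"] unfolding z G_def by auto
    qed
    ultimately show ?thesis by simp
  qed
  then have "euclidean closure_of \<Inter>(G ` (D \<times> UNIV)) = topspace euclidean"
    using D(1) by (intro Baire_category) (auto simp: completely_metrizable_space_euclidean)
  then have "\<Inter>(G ` (D \<times> UNIV)) \<noteq> {}"
    by (metis closure_of_empty empty_not_UNIV topspace_euclidean)
  then obtain x where x: "\<And>d n. d \<in> D \<Longrightarrow> x \<in> G (d, n)"
    by auto
  have "closure (range (\<lambda>i. f i x)) = UNIV"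
  proof (rule denseI)
    fix V :: "'b set" assume V: "open V" "V \<noteq> {}"
    then obtain v e where ve: "e > 0" "ball v e \<subseteq> V"
      by (meson ex_in_conv openE)
    obtain n where n: "inverse (real (Suc n)) < e / 2"
      using reals_Archimedean[of "e / 2"] ve by auto
    obtain d where d: "d \<in> D" "d \<in> ball v (inverse (Suc n))"
      using dense_meets_open[OF D(2), of "ball v (inverse (Suc n))"] by auto
    obtain i where "dist d (f i x) < inverse (Suc n)"
      using x[OF d(1), of n] unfolding G_def by auto
    then have "dist v (f i x) < e"
      using n d(2) dist_triangle[of v "f i x" d] by simp
    then show "\<exists>a\<in>range (\<lambda>i. f i x). a \<in> V"
      using ve(2) by auto
  qed
  then show ?thesis ..
qed

lemma continuous_on_funpow:
  fixes T :: "'a::topological_space \<Rightarrow> 'a"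
  assumes "continuous_on UNIV T"
  shows "continuous_on UNIV (T ^^ n)"
proof (induction n)
  case (Suc n)
  then show ?case
    using assms continuous_on_compose[of UNIV "T ^^ n" T] continuous_on_subset by auto
qed (simp add: continuous_on_id id_def)

text \<open>The points \<open>u + w / (n + 1)\<close> are distinct and converge to \<open>u\<close>,
  so all but finitely many lie in \<open>U\<close>. The vector \<open>w\<close> records that the
  space is nontrivial.\<close>

lemma open_infinite:
  fixes U :: "'a::real_normed_vector set"
  assumes "open U" "u \<in> U" "(w::'a) \<noteq> 0"
  shows "infinite U"
proof
  assume fin: "finite U"
  have "\<forall>\<^sub>F n in sequentially. u + inverse (real (Suc n)) *\<^sub>R w \<in> U"
  proof (rule topological_tendstoD[OF _ assms(1,2)])
    show "(\<lambda>n. u + inverse (real (Suc n)) *\<^sub>R w) \<longlonglongrightarrow> u"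
      using tendsto_add[OF tendsto_const tendsto_scaleR[OF LIMSEQ_inverse_real_of_nat tendsto_const]]
      by fastforce
  qed
  then obtain N where N: "\<And>n. n \<ge> N \<Longrightarrow> u + inverse (real (Suc n)) *\<^sub>R w \<in> U"
    unfolding eventually_sequentially by auto
  have "inj_on (\<lambda>n. u + inverse (real (Suc n)) *\<^sub>R w) {N..}"
    using assms(3) by (auto simp: inj_on_def)
  then have "infinite ((\<lambda>n. u + inverse (real (Suc n)) *\<^sub>R w) ` {N..})"
    using finite_imageD infinite_Ici by blast
  then show False
    using fin N finite_subset[of "(\<lambda>n. u + inverse (real (Suc n)) *\<^sub>R w) ` {N..}" U] by auto
qed

text \<open>Removing the first \<open>m\<close> values from \<open>V\<close> leaves an open set,
  nonempty because \<open>V\<close> is infinite; any hit in it occurs at time \<open>m\<close> or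
  later.\<close>

lemma dense_orbit_frequently:
  fixes f :: "nat \<Rightarrow> 'a::real_normed_vector"
  assumes "closure (range f) = UNIV" "open V" "V \<noteq> {}" "(w::'a) \<noteq> 0"
  shows "\<exists>n\<ge>m. f n \<in> V"
proof -
  have "open (V - f ` {..<m})"
    using assms(2) by (simp add: open_Diff finite_imp_closed)
  moreover have "V - f ` {..<m} \<noteq> {}"
    using open_infinite[OF assms(2) _ assms(4)] assms(3)
    by (metis Diff_eq_empty_iff ex_in_conv finite_imageI finite_lessThan finite_subset)
  ultimately obtain n where "f n \<in> V - f ` {..<m}"
    using dense_meets_open[OF assms(1)] by blast
  then show ?thesis
    by (metis DiffD1 DiffD2 imageI lessThan_iff not_le)
qed

text \<open>One dense orbit visits \<open>U\<close> at some time \<open>m\<close> and then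
  \<open>V\<close> at some time \<open>n \<ge> m\<close>; the point wanted is the orbit point at
  time \<open>m\<close>.\<close>

lemma hypercyclic_imp_transitive:
  fixes T :: "'a::real_normed_vector \<Rightarrow> 'a"
  assumes "hypercyclic T" "(w::'a) \<noteq> 0" "open U" "U \<noteq> {}" "open V" "V \<noteq> {}"
  obtains n x where "x \<in> U" "(T ^^ n) x \<in> V"
proof -
  obtain x where x: "closure (range (\<lambda>n. (T ^^ n) x)) = UNIV"
    using assms(1) unfolding hypercyclic_def by auto
  obtain m where m: "(T ^^ m) x \<in> U"
    using dense_orbit_frequently[OF x assms(3,4,2)] by blast
  obtain n where "n \<ge> m" "(T ^^ n) x \<in> V"
    using dense_orbit_frequently[OF x assms(5,6,2)] by blast
  then have "(T ^^ (n - m)) ((T ^^ m) x) \<in> V"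
    by (metis comp_apply funpow_add le_add_diff_inverse2)
  with m show ?thesis by (rule that)
qed

section \<open>From a hypercyclic direct sum to the Hypercyclicity Criterion\<close>

lemma funpow_dsum: "(dsum T ^^ n) (x, y) = ((T ^^ n) x, (T ^^ n) y)"
  by (induction n) (auto simp: dsum_def)

lemma hypercyclic_dsum_imp_criterion:
  fixes T :: "'a::real_normed_vector \<Rightarrow> 'a"
  assumes T: "bounded_linear T" and hyp: "hypercyclic (dsum T)" and w: "(w::'a) \<noteq> 0"
  shows "hypercyclicity_criterion T"
proof -
  obtain x y where xy: "closure (range (\<lambda>n. ((T ^^ n) x, (T ^^ n) y))) = UNIV"
    using hyp unfolding hypercyclic_def by (metis (no_types, lifting) funpow_dsum surj_pair image_cong)
  \<comment> \<open>The tolerance 1 is enough for the second coordinate: dividing by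
    \<open>Suc k\<close> later turns it into an error of at most \<open>1 / (k + 1)\<close> between
    \<open>(T ^^ n k) (u k)\<close> and \<open>x\<close>.\<close>
  let ?P = "\<lambda>k n. norm ((T ^^ n) x) < inverse (Suc k) \<and> norm ((T ^^ n) y - real (Suc k) *\<^sub>R x) < 1"
  have ex: "\<exists>n\<ge>m. ?P k n" for k m
  proof -
    have "open (ball 0 (inverse (Suc k)) \<times> ball (real (Suc k) *\<^sub>R x) 1)"
      by (intro open_Times) auto
    moreover have "ball (0::'a) (inverse (Suc k)) \<times> ball (real (Suc k) *\<^sub>R x) 1 \<noteq> {}"
      by auto
    moreover have "(w, w) \<noteq> 0" using w by (simp add: zero_prod_def)
    ultimately obtain n where "n \<ge> m"
      "((T ^^ n) x, (T ^^ n) y) \<in> ball 0 (inverse (Suc k)) \<times> ball (real (Suc k) *\<^sub>R x) 1"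
      using dense_orbit_frequently[OF xy] by blast
    then show ?thesis by (auto simp: dist_norm norm_minus_commute)
  qed
  \<comment> \<open>Starting from the lower bound 1 makes the exponents positive; the lower bound
    \<open>Suc n\<close> at each later stage makes them strictly increasing.\<close>
  have "\<exists>n. \<forall>k. (n k > 0 \<and> ?P k (n k)) \<and> n (Suc k) > n k"
  proof (rule dependent_nat_choice)
    show "\<exists>n>0. ?P 0 n"
      using ex[of 1 0] by (meson less_le_trans zero_less_one)
    show "\<exists>n'. (n' > 0 \<and> ?P (Suc k) n') \<and> n' > n" for n k
      using ex[of "Suc n" "Suc k"] by (meson Suc_le_eq less_le_trans zero_less_Suc)
  qed
  then obtain n where n: "\<And>k. n k > 0" "\<And>k. ?P k (n k)" "\<And>k. n (Suc k) > n k"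
    by blast
  define u where "u k = inverse (real (Suc k)) *\<^sub>R y" for k
  have linT: "linear (T ^^ m)" for m
  proof (induction m)
    case (Suc m)
    then show ?case
      using linear_compose[OF Suc bounded_linear.linear[OF T]] by (simp only: funpow.simps)
  qed (simp add: linear_iff)
  have contT: "isCont (T ^^ m) z" for m z
    using continuous_on_funpow[of T m] T linear_continuous_on[of T UNIV]
      continuous_on_eq_continuous_at open_UNIV by blast
  have comm: "(T ^^ i) ((T ^^ j) z) = (T ^^ j) ((T ^^ i) z)" for i j z
    by (metis add.commute comp_apply funpow_add)
  have inv0: "(\<lambda>k. inverse (real (Suc k))) \<longlonglongrightarrow> 0"
    by (rule LIMSEQ_inverse_real_of_nat)
  have x0: "(\<lambda>k. (T ^^ n k) x) \<longlonglongrightarrow> 0"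
    using n(2) by (intro Lim_null_comparison[OF _ inv0]) (auto intro!: always_eventually less_imp_le)
  have u0: "u \<longlonglongrightarrow> 0"
    using tendsto_scaleR[OF inv0 tendsto_const[of y]] unfolding u_def by simp
  have ux: "(\<lambda>k. (T ^^ n k) (u k)) \<longlonglongrightarrow> x"
  proof -
    have "norm ((T ^^ n k) (u k) - x) \<le> inverse (real (Suc k))" for k
    proof -
      have "(T ^^ n k) (u k) - x = inverse (real (Suc k)) *\<^sub>R ((T ^^ n k) y - real (Suc k) *\<^sub>R x)"
        unfolding u_def linear_scale[OF linT] scaleR_diff_right
        by (simp del: of_nat_Suc)
      also have "norm \<dots> = inverse (real (Suc k)) * norm ((T ^^ n k) y - real (Suc k) *\<^sub>R x)"
        by simp
      also have "\<dots> \<le> inverse (real (Suc k)) * 1"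
        using n(2)[of k] by (intro mult_left_mono) auto
      finally show ?thesis by simp
    qed
    then have "(\<lambda>k. (T ^^ n k) (u k) - x) \<longlonglongrightarrow> 0"
      by (intro Lim_null_comparison[OF _ inv0]) auto
    then show ?thesis by (simp add: LIM_zero_iff)
  qed
  define X where "X = range (\<lambda>m. (T ^^ m) x)"
  \<comment> \<open>The approximate right inverse should send \<open>(T ^^ m) x\<close> to
    \<open>(T ^^ m) (u k)\<close>. Fixing one exponent for each orbit point makes this a map of the
    point itself.\<close>
  define idx where "idx z = (SOME m. z = (T ^^ m) x)" for z
  have idx: "z = (T ^^ idx z) x" if "z \<in> X" for z
    using that unfolding X_def idx_def by (metis (mono_tags, lifting) imageE someI_ex)
  have "closure X = UNIV"
  proof (rule denseI)
    fix U :: "'a set" assume "open U" "U \<noteq> {}"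
    then have "open (U \<times> (UNIV::'a set))" "U \<times> (UNIV::'a set) \<noteq> {}"
      by (auto intro: open_Times)
    from dense_meets_open[OF xy this] show "\<exists>a\<in>X. a \<in> U"
      unfolding X_def by auto
  qed
  moreover have "strict_mono n"
    using n(3) by (simp add: strict_mono_Suc_iff)
  \<comment> \<open>Powers of \<open>T\<close> commute, so the continuous map
    \<open>T ^^ idx z\<close> carries the limit known at \<open>x\<close> over to \<open>z\<close>.
    The last of the three limits is obtained in the same way from \<open>ux\<close>.\<close>
  moreover have "(\<lambda>k. (T ^^ n k) z) \<longlonglongrightarrow> 0" if "z \<in> X" for z
  proof -
    have "(\<lambda>k. (T ^^ idx z) ((T ^^ n k) x)) \<longlonglongrightarrow> (T ^^ idx z) 0"
      by (rule isCont_tendsto_compose[OF contT x0])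
    moreover have "(T ^^ n k) z = (T ^^ idx z) ((T ^^ n k) x)" for k
      by (rule trans[OF arg_cong[OF idx[OF that], of "T ^^ n k"] comm])
    ultimately show ?thesis
      by (simp only: linear_0[OF linT])
  qed
  moreover have "(\<lambda>k. (T ^^ idx z) (u k)) \<longlonglongrightarrow> 0" for z
    using isCont_tendsto_compose[OF contT u0, of "idx z"] by (simp only: linear_0[OF linT])
  moreover have "(\<lambda>k. (T ^^ n k) ((T ^^ idx z) (u k))) \<longlonglongrightarrow> z" if "z \<in> X" for z
    using isCont_tendsto_compose[OF contT ux, of "idx z"]
    by (simp only: comm[of "idx z"] idx[OF that, symmetric])
  ultimately show ?thesis
    unfolding hypercyclicity_criterion_def using n(1)
    by (intro exI[of _ X] exI[of _ n]
        exI[of _ "\<lambda>k z. (T ^^ idx z) (u k)"]) simp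
qed

section \<open>Polynomials in an operator\<close>

text \<open>A common frame for real and complex scalars. It is also interpreted at
  \<open>prod_smult sm\<close>, so that the facts on polynomials in an operator apply to direct
  sums.\<close>

locale continuous_scalars = vector_space sm
  for sm :: "'k::field \<Rightarrow> 'a::banach \<Rightarrow> 'a" +
  assumes continuous_scale: "continuous_on UNIV (sm c)"
begin

lemma kspan_eq_span: "kspan sm V = span V"
  unfolding kspan_def span_explicit by auto

text \<open>Padding with zero coefficients lets polynomials of different degrees be summed over the
  same range.\<close>

lemma poly_op_eq_sum:
  assumes "degree p \<le> n"
  shows "poly_op sm p A x = (\<Sum>i\<le>n. sm (coeff p i) ((A ^^ i) x))"
  unfolding poly_op_def using assms
  by (intro sum.mono_neutral_left) (auto simp: coeff_eq_0)

lemma poly_op_0 [simp]: "poly_op sm 0 A x = 0"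
  by (simp add: poly_op_def)

lemma poly_op_add: "poly_op sm (p + q) A x = poly_op sm p A x + poly_op sm q A x"
  using poly_op_eq_sum[of p "max (degree p) (degree q)" A x]
    poly_op_eq_sum[of q "max (degree p) (degree q)" A x]
    poly_op_eq_sum[OF degree_add_le_max, of p q A x]
  by (simp add: scale_left_distrib sum.distrib)

lemma poly_op_smult: "poly_op sm (smult c p) A x = sm c (poly_op sm p A x)"
  using poly_op_eq_sum[OF degree_smult_le, of c p A x]
  by (simp add: poly_op_def scale_sum_right)

lemma poly_op_monom: "poly_op sm (monom c n) A x = sm c ((A ^^ n) x)"
proof -
  have "poly_op sm (monom c n) A x = (\<Sum>i\<le>n. if i = n then sm c ((A ^^ i) x) else 0)"
    unfolding poly_op_eq_sum[OF degree_monom_le] by (intro sum.cong) auto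
  then show ?thesis by simp
qed

lemma bop_sum_scale:
  assumes "bop sm A"
  shows "A (\<Sum>i\<in>I. sm (c i) (f i)) = (\<Sum>i\<in>I. sm (c i) (A (f i)))"
  using assms unfolding bop_def by (simp add: linear_sum bounded_linear.linear)

text \<open>Horner's recursion, on which the later inductions over polynomials rest.\<close>

lemma poly_op_pCons:
  assumes "bop sm A"
  shows "poly_op sm (pCons a p) A x = sm a x + A (poly_op sm p A x)"
proof -
  have "poly_op sm (pCons a p) A x = (\<Sum>i\<le>Suc (degree p). sm (coeff (pCons a p) i) ((A ^^ i) x))"
    by (rule poly_op_eq_sum) (rule degree_pCons_le)
  also have "\<dots> = sm a x + (\<Sum>i\<le>degree p. sm (coeff p i) (A ((A ^^ i) x)))"
    by (subst sum.atMost_Suc_shift) simp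
  finally show ?thesis
    unfolding poly_op_def bop_sum_scale[OF assms] .
qed

lemma poly_op_funpow:
  assumes "bop sm A"
  shows "poly_op sm p A ((A ^^ n) x) = (A ^^ n) (poly_op sm p A x)"
proof (induction n)
  case (Suc n)
  have "poly_op sm p A (A z) = A (poly_op sm p A z)" for z
    unfolding poly_op_def bop_sum_scale[OF assms] by (simp add: funpow_swap1)
  with Suc show ?case by simp
qed simp

lemma additive_poly_op:
  assumes "bop sm A"
  shows "poly_op sm p A (x + y) = poly_op sm p A x + poly_op sm p A y"
proof (induction p)
  case (pCons a p)
  then show ?case
    using assms unfolding poly_op_pCons[OF assms] bop_def
    by (simp add: scale_right_distrib bounded_linear.linear linear_add)
qed simp

lemma bop_continuous:
  assumes "bop sm A"
  shows "continuous_on UNIV A"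
  using assms linear_continuous_on unfolding bop_def by blast

lemma continuous_poly_op:
  assumes "bop sm A"
  shows "continuous_on UNIV (poly_op sm p A)"
proof (induction p)
  case 0
  have "poly_op sm 0 A = (\<lambda>x. 0)" by auto
  then show ?case by simp
next
  case (pCons a p)
  have "continuous_on UNIV (\<lambda>x. A (poly_op sm p A x))"
    using continuous_on_compose2[OF bop_continuous[OF assms] pCons(2)] by simp
  then show ?case
    unfolding poly_op_pCons[OF assms, abs_def]
    by (intro continuous_on_add continuous_scale)
qed

text \<open>Since \<open>T\<close> is the value at \<open>S\<close> of the polynomial
  \<open>lam + X\<close>, substituting that polynomial into \<open>p\<close> converts
  \<open>p(T)\<close> into a polynomial in \<open>S\<close>. Horner's recursion on both sides
  reduces this to one application of \<open>T\<close>.\<close>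

lemma poly_op_shift:
  assumes "bop sm T" "bop sm S" "\<And>x. T x = sm lam x + S x"
  shows "poly_op sm p T x = poly_op sm (p \<circ>\<^sub>p [:lam, 1:]) S x"
proof (induction p)
  case (pCons a p)
  let ?q = "p \<circ>\<^sub>p [:lam, 1:]"
  have "pCons a p \<circ>\<^sub>p [:lam, 1:] = smult lam ?q + pCons a ?q"
    by (simp add: pcompose_pCons)
  then have "poly_op sm (pCons a p \<circ>\<^sub>p [:lam, 1:]) S x =
      sm a x + (sm lam (poly_op sm ?q S x) + S (poly_op sm ?q S x))"
    by (simp add: poly_op_pCons[OF assms(2)] poly_op_add poly_op_smult)
  also have "\<dots> = sm a x + T (poly_op sm p T x)"
    by (simp only: pCons(2) assms(3)[of "poly_op sm ?q S x"])
  finally show ?case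
    unfolding poly_op_pCons[OF assms(1)] ..
qed simp

text \<open>The values \<open>p(A) x\<close> form a subspace that contains the orbit through the
  monomials. Cyclicity thus becomes density of these values, the form used from here on.\<close>

lemma span_orbit: "span (range (\<lambda>n. (A ^^ n) x)) = range (\<lambda>p. poly_op sm p A x)"
proof
  show "span (range (\<lambda>n. (A ^^ n) x)) \<subseteq> range (\<lambda>p. poly_op sm p A x)"
  proof (rule span_minimal)
    show "subspace (range (\<lambda>p. poly_op sm p A x))"
      by (auto simp: subspace_def simp flip: poly_op_add poly_op_smult
          intro: range_eqI[where x = 0])
    show "range (\<lambda>n. (A ^^ n) x) \<subseteq> range (\<lambda>p. poly_op sm p A x)"
      by (auto intro: range_eqI[where x = "monom 1 _"] simp: poly_op_monom)
  qed
  show "range (\<lambda>p. poly_op sm p A x) \<subseteq> span (range (\<lambda>n. (A ^^ n) x))"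
    unfolding poly_op_def by (intro image_subsetI span_sum span_scale span_base rangeI)
qed

lemma cyclic_iff_poly_op: "cyclic sm A \<longleftrightarrow> (\<exists>x. closure (range (\<lambda>p. poly_op sm p A x)) = UNIV)"
  unfolding cyclic_def kspan_eq_span span_orbit ..

text \<open>The same vector works, as every \<open>p(T) x\<close> is also a polynomial in
  \<open>S\<close> applied to \<open>x\<close>. The converse is the same lemma with
  \<open>- lam\<close>, with \<open>T\<close> and \<open>S\<close> exchanged.\<close>

lemma cyclic_shift:
  assumes "bop sm T" "bop sm S" "\<And>x. T x = sm lam x + S x" "cyclic sm T"
  shows "cyclic sm S"
proof -
  obtain x where x: "closure (range (\<lambda>p. poly_op sm p T x)) = UNIV"
    using assms(4) unfolding cyclic_iff_poly_op by auto
  have "range (\<lambda>p. poly_op sm p T x) \<subseteq> range (\<lambda>p. poly_op sm p S x)"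
    using poly_op_shift[OF assms(1-3)] by auto
  then have "closure (range (\<lambda>p. poly_op sm p S x)) = UNIV"
    using closure_mono x by blast
  then show ?thesis
    unfolding cyclic_iff_poly_op ..
qed

lemma cyclicity_criterion_shift:
  assumes "bop sm T" "bop sm S" "\<And>x. T x = sm lam x + S x" "cyclicity_criterion sm T"
  shows "cyclicity_criterion sm S"
proof -
  obtain V W p R where *: "closure V = UNIV" "closure W = UNIV"
    "\<forall>x\<in>V. (\<lambda>k. poly_op sm (p k) T x) \<longlonglongrightarrow> 0" "\<forall>x\<in>W. (\<lambda>k. R k x) \<longlonglongrightarrow> 0"
    "\<forall>x\<in>W. (\<lambda>k. poly_op sm (p k) T (R k x)) \<longlonglongrightarrow> x"
    using assms(4) unfolding cyclicity_criterion_def by (elim exE conjE) rule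
  show ?thesis
    unfolding cyclicity_criterion_def
    by (rule exI[of _ V], rule exI[of _ W], rule exI[of _ "\<lambda>k. p k \<circ>\<^sub>p [:lam, 1:]"], rule exI[of _ R])
      (use * in \<open>simp add: poly_op_shift[OF assms(1-3)]\<close>)
qed

text \<open>The powers \<open>T ^^ n k\<close> are the polynomials \<open>X^(n k)\<close> evaluated
  at \<open>T\<close>.\<close>

lemma hypercyclicity_criterion_imp_cyclicity_criterion:
  assumes "hypercyclicity_criterion T"
  shows "cyclicity_criterion sm T"
proof -
  obtain X0 Y0 n R where *: "closure X0 = UNIV" "closure Y0 = UNIV"
    "\<forall>x\<in>X0. (\<lambda>k. (T ^^ n k) x) \<longlonglongrightarrow> 0" "\<forall>y\<in>Y0. (\<lambda>k. R k y) \<longlonglongrightarrow> 0"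
    "\<forall>y\<in>Y0. (\<lambda>k. (T ^^ n k) (R k y)) \<longlonglongrightarrow> y"
    using assms unfolding hypercyclicity_criterion_def by (elim exE conjE) rule
  show ?thesis
    unfolding cyclicity_criterion_def
    by (rule exI[of _ X0], rule exI[of _ Y0], rule exI[of _ "\<lambda>k. monom 1 (n k)"], rule exI[of _ R])
      (use * in \<open>simp add: poly_op_monom\<close>)
qed

section \<open>Direct sums and polynomials in them\<close>

lemma continuous_scalars_prod: "continuous_scalars (prod_smult sm)"
proof
  fix c :: 'k
  have "continuous_on UNIV (\<lambda>z. (sm c (fst z), sm c (snd z)))"
    by (intro continuous_on_Pair continuous_on_compose2[OF continuous_scale]
        continuous_on_fst continuous_on_snd continuous_on_id) auto
  then show "continuous_on UNIV (prod_smult sm c)"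
    unfolding prod_smult_def .
qed (auto simp: prod_smult_def scale_right_distrib scale_left_distrib)

lemma bop_dsum:
  assumes "bop sm A"
  shows "bop (prod_smult sm) (dsum A)"
proof -
  have "bounded_linear A" using assms unfolding bop_def by simp
  then have "bounded_linear (\<lambda>z. (A (fst z), A (snd z)))"
    using bounded_linear_compose bounded_linear_fst bounded_linear_snd by (intro bounded_linear_Pair) blast+
  then show ?thesis
    using assms unfolding bop_def dsum_def prod_smult_def by simp
qed

lemma poly_op_dsum:
  "poly_op (prod_smult sm) p (dsum A) (x, y) = (poly_op sm p A x, poly_op sm p A y)"
  unfolding poly_op_def funpow_dsum prod_smult_def by (simp add: sum_prod)

text \<open>The criterion uses the same polynomials \<open>p k\<close> for all points, so it can be
  applied in both coordinates at once. This makes the sequence \<open>p k (A \<oplus> A)\<close>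
  transitive, and a universal vector for that sequence is cyclic.\<close>

lemma cyclicity_criterion_imp_cyclic_dsum:
  assumes sep: "separable_space TYPE('a)" and A: "bop sm A" and crit: "cyclicity_criterion sm A"
  shows "cyclic (prod_smult sm) (dsum A)"
proof -
  interpret P: continuous_scalars "prod_smult sm" by (rule continuous_scalars_prod)
  obtain V W p R where V: "closure V = UNIV" and W: "closure W = UNIV"
    and pV: "\<forall>x\<in>V. (\<lambda>k. poly_op sm (p k) A x) \<longlonglongrightarrow> 0"
    and R: "\<forall>x\<in>W. (\<lambda>k. R k x) \<longlonglongrightarrow> 0"
    and pR: "\<forall>x\<in>W. (\<lambda>k. poly_op sm (p k) A (R k x)) \<longlonglongrightarrow> x"
    using crit unfolding cyclicity_criterion_def by (elim exE conjE) rule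
  let ?F = "\<lambda>k::nat. poly_op (prod_smult sm) (p k) (dsum A)"
  have "\<exists>z. closure (range (\<lambda>k. ?F k z)) = UNIV"
  proof (rule transitive_imp_universal[OF separable_space_prod[OF sep]])
    show "continuous_on UNIV (?F k)" for k
      by (rule P.continuous_poly_op[OF bop_dsum[OF A]])
  next
    fix U O' :: "('a \<times> 'a) set"
    assume U: "open U" "U \<noteq> {}" and O': "open O'" "O' \<noteq> {}"
    have VV: "closure (V \<times> V) = UNIV" and WW: "closure (W \<times> W) = UNIV"
      by (auto simp: closure_Times V W)
    obtain v1 v2 where v: "v1 \<in> V" "v2 \<in> V" "(v1, v2) \<in> U"
      by (rule dense_meets_open[OF VV U]) auto
    obtain w1 w2 where w: "w1 \<in> W" "w2 \<in> W" "(w1, w2) \<in> O'"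
      by (rule dense_meets_open[OF WW O']) auto
    \<comment> \<open>The correction \<open>R k w\<close> tends to 0, so \<open>?z k\<close> stays
      near \<open>v\<close>; \<open>p k (A)\<close> kills \<open>v\<close> in the limit and sends
      the correction to \<open>w\<close>.\<close>
    let ?z = "\<lambda>k. (v1 + R k w1, v2 + R k w2)"
    have "?z \<longlonglongrightarrow> (v1 + 0, v2 + 0)"
      by (intro tendsto_intros bspec[OF R] w)
    then have 1: "\<forall>\<^sub>F k in sequentially. ?z k \<in> U"
      using v(3) by (intro topological_tendstoD[OF _ U(1)]) auto
    have "(\<lambda>k. ?F k (?z k)) \<longlonglongrightarrow> (0 + w1, 0 + w2)"
      unfolding poly_op_dsum additive_poly_op[OF A]
      by (intro tendsto_intros bspec[OF pV] bspec[OF pR] v w)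
    then have 2: "\<forall>\<^sub>F k in sequentially. ?F k (?z k) \<in> O'"
      using w(3) by (intro topological_tendstoD[OF _ O'(1)]) auto
    show "\<exists>k. \<exists>z\<in>U. ?F k z \<in> O'"
      using eventually_happens[OF eventually_conj[OF 1 2]] by auto
  qed
  then obtain z where z: "closure (range (\<lambda>k. ?F k z)) = UNIV" ..
  \<comment> \<open>The polynomials \<open>p k\<close> alone already give a dense set of values at
    \<open>z\<close>.\<close>
  have "range (\<lambda>k. ?F k z) \<subseteq> range (\<lambda>q. poly_op (prod_smult sm) q (dsum A) z)"
    by auto
  then have "closure (range (\<lambda>q. poly_op (prod_smult sm) q (dsum A) z)) = UNIV"
    using closure_mono z by blast
  then show ?thesis
    unfolding P.cyclic_iff_poly_op ..
qed

lemma cyclic_dsum_imp_hypercyclic_dsum: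
  assumes sep: "separable_space TYPE('a)" and nontrivial: "(w::'a) \<noteq> 0"
    and T: "bop sm T" and hyp: "hypercyclic T" and cyc: "cyclic (prod_smult sm) (dsum T)"
  shows "hypercyclic (dsum T)"
proof -
  interpret P: continuous_scalars "prod_smult sm" by (rule continuous_scalars_prod)
  obtain x y where "closure (range (\<lambda>p. poly_op (prod_smult sm) p (dsum T) (x, y))) = UNIV"
    using cyc unfolding P.cyclic_iff_poly_op by auto
  then have xy: "closure (range (\<lambda>p. (poly_op sm p T x, poly_op sm p T y))) = UNIV"
    unfolding poly_op_dsum .
  have pre: "open (poly_op sm p T -` U)" if "open U" for p U
    using that continuous_poly_op[OF T] by (simp add: open_vimage)
  show ?thesis
    unfolding hypercyclic_def
  proof (rule transitive_imp_universal[OF separable_space_prod[OF sep]])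
    show "continuous_on UNIV (dsum T ^^ n)" for n
      by (intro continuous_on_funpow P.bop_continuous bop_dsum T)
  next
    fix U V :: "('a \<times> 'a) set"
    assume open_U: "open U" and "U \<noteq> {}" and open_V: "open V" and "V \<noteq> {}"
    then obtain u v where "u \<in> U" "v \<in> V" by blast
    obtain U1 U2 where U: "open U1" "open U2" "u \<in> U1 \<times> U2" "U1 \<times> U2 \<subseteq> U"
      using open_prod_elim[OF open_U \<open>u \<in> U\<close>] .
    obtain V1 V2 where V: "open V1" "open V2" "v \<in> V1 \<times> V2" "V1 \<times> V2 \<subseteq> V"
      using open_prod_elim[OF open_V \<open>v \<in> V\<close>] .
    \<comment> \<open>The factors are regrouped: one polynomial handles both first coordinates, the
      other both second ones.\<close>
    have ne: "U1 \<times> V1 \<noteq> {}" "U2 \<times> V2 \<noteq> {}"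
      using U(3) V(3) by auto
    obtain p where p: "poly_op sm p T x \<in> U1" "poly_op sm p T y \<in> V1"
      by (rule dense_meets_open[OF xy open_Times[OF U(1) V(1)] ne(1)]) auto
    obtain q where q: "poly_op sm q T x \<in> U2" "poly_op sm q T y \<in> V2"
      by (rule dense_meets_open[OF xy open_Times[OF U(2) V(2)] ne(2)]) auto
    \<comment> \<open>\<open>?N\<close> is a neighbourhood of \<open>x\<close> and \<open>?M\<close>
      one of \<open>y\<close>. Pulling back along \<open>p(T)\<close> and \<open>q(T)\<close>
      reduces transitivity on the product to transitivity of \<open>T\<close> alone.\<close>
    let ?N = "poly_op sm p T -` U1 \<inter> poly_op sm q T -` U2"
    let ?M = "poly_op sm p T -` V1 \<inter> poly_op sm q T -` V2"
    have "open ?N" "?N \<noteq> {}" "open ?M" "?M \<noteq> {}"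
      using p q U V pre by auto
    then obtain n x' where "x' \<in> ?N" "(T ^^ n) x' \<in> ?M"
      by (rule hypercyclic_imp_transitive[OF hyp nontrivial])
    then have "(poly_op sm p T x', poly_op sm q T x') \<in> U1 \<times> U2"
      "(dsum T ^^ n) (poly_op sm p T x', poly_op sm q T x') \<in> V1 \<times> V2"
      unfolding funpow_dsum by (auto simp: poly_op_funpow[OF T])
    then show "\<exists>n. \<exists>z\<in>U. (dsum T ^^ n) z \<in> V"
      by (intro exI bexI) (rule subsetD[OF V(4)], assumption, rule subsetD[OF U(4)])
  qed
qed

theorem hypercyclic_criteria_equivalent:
  assumes sep: "separable_space TYPE('a)" and infdim: "infinite_dimensional sm"
    and T: "bop sm T" and S: "bop sm S" and TS: "\<And>x. T x = sm lam x + S x"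
    and hyp: "hypercyclic T"
  shows "(hypercyclicity_criterion T \<longleftrightarrow> cyclicity_criterion sm T) \<and>
      (cyclicity_criterion sm T \<longleftrightarrow> cyclicity_criterion sm S) \<and>
      (cyclicity_criterion sm S \<longleftrightarrow> cyclic (prod_smult sm) (dsum S)) \<and>
      (cyclic (prod_smult sm) (dsum S) \<longleftrightarrow> cyclic (prod_smult sm) (dsum T)) \<and>
      (cyclic (prod_smult sm) (dsum T) \<longleftrightarrow> hypercyclic (dsum T))"
proof -
  interpret P: continuous_scalars "prod_smult sm" by (rule continuous_scalars_prod)
  \<comment> \<open>In the zero space the empty set would already span everything.\<close>
  obtain w :: 'a where w: "w \<noteq> 0"
  proof (rule ccontr)
    assume "\<not> thesis"
    then have "(UNIV :: 'a set) = {0}" using that by auto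
    then have "kspan sm {} = UNIV" by (simp add: kspan_eq_span)
    then show False using infdim unfolding infinite_dimensional_def by blast
  qed
  \<comment> \<open>Solving for \<open>S\<close> gives a relation of the same form, so each shift
    lemma can be used in both directions, on the space and on its square.\<close>
  have ST: "S x = sm (- lam) x + T x" for x
    by (simp add: TS)
  have dTS: "dsum T z = prod_smult sm lam z + dsum S z" for z
    by (simp add: dsum_def prod_smult_def TS)
  have dST: "dsum S z = prod_smult sm (- lam) z + dsum T z" for z
    by (simp add: dsum_def prod_smult_def TS)
  \<comment> \<open>The implications close the cycle (i), (ii), (v), (vi), (i); the shifts then
    attach (iii) to (ii) and (iv) to (v).\<close>
  have "hypercyclicity_criterion T \<Longrightarrow> cyclicity_criterion sm T"
    by (rule hypercyclicity_criterion_imp_cyclicity_criterion)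
  moreover have "cyclicity_criterion sm T \<Longrightarrow> cyclic (prod_smult sm) (dsum T)"
    by (rule cyclicity_criterion_imp_cyclic_dsum[OF sep T])
  moreover have "cyclic (prod_smult sm) (dsum T) \<Longrightarrow> hypercyclic (dsum T)"
    by (rule cyclic_dsum_imp_hypercyclic_dsum[OF sep w T hyp])
  moreover have "hypercyclic (dsum T) \<Longrightarrow> hypercyclicity_criterion T"
    using T w by (auto simp: bop_def intro: hypercyclic_dsum_imp_criterion)
  moreover have "cyclicity_criterion sm T \<longleftrightarrow> cyclicity_criterion sm S"
    using cyclicity_criterion_shift[OF T S TS] cyclicity_criterion_shift[OF S T ST] by blast
  moreover have "cyclic (prod_smult sm) (dsum S) \<longleftrightarrow> cyclic (prod_smult sm) (dsum T)"
    using P.cyclic_shift[OF bop_dsum[OF T] bop_dsum[OF S] dTS]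
      P.cyclic_shift[OF bop_dsum[OF S] bop_dsum[OF T] dST] by blast
  ultimately show ?thesis by blast
qed

end

section \<open>The real and complex scalar fields\<close>

lemma continuous_scalars_real: "continuous_scalars ((*\<^sub>R) :: real \<Rightarrow> 'a::banach \<Rightarrow> 'a)"
  by unfold_locales (auto simp: scaleR_right_distrib scaleR_left_distrib intro: continuous_intros)

lemma continuous_scalars_complex:
  fixes cs :: "complex \<Rightarrow> 'a::banach \<Rightarrow> 'a"
  assumes "complex_scalar_mult cs"
  shows "continuous_scalars cs"
proof
  have cs: "\<And>r x. cs (complex_of_real r) x = r *\<^sub>R x" "\<And>a b x. cs (a * b) x = cs a (cs b x)"
    "\<And>a b x. cs (a + b) x = cs a x + cs b x" "\<And>a x y. cs a (x + y) = cs a x + cs a y"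
    "\<And>a x. norm (cs a x) = cmod a * norm x"
    using assms unfolding complex_scalar_mult_def by auto
  show "cs a (x + y) = cs a x + cs a y" "cs (a + b) x = cs a x + cs b x"
    "cs a (cs b x) = cs (a * b) x" "cs 1 x = x" for a b x y
    using cs(2-4) cs(1)[of 1 x] by simp_all
  fix c
  \<comment> \<open>Real scalars act as complex ones and complex multiplication commutes, so
    \<open>cs c\<close> is real-linear; the norm identity bounds it by
    \<open>cmod c\<close>.\<close>
  have "cs c (r *\<^sub>R x) = r *\<^sub>R cs c x" for r x
    by (metis cs(1,2) mult.commute)
  then have "bounded_linear (cs c)"
    using cs(4,5) by (intro bounded_linear_intro[where K = "cmod c"]) (auto simp: mult.commute)
  then show "continuous_on UNIV (cs c)"
    by (rule linear_continuous_on)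
qed

theorem mainTheorem1:
  shows
  "(\<forall>(T::'a::banach \<Rightarrow> 'a) S (lam::real).
      separable_space TYPE('a) \<and> infinite_dimensional ((*\<^sub>R) :: real \<Rightarrow> 'a \<Rightarrow> 'a) \<and>
      bop (*\<^sub>R) T \<and> bop (*\<^sub>R) S \<and> (\<forall>x. T x = lam *\<^sub>R x + S x) \<and> hypercyclic T \<longrightarrow>
      (hypercyclicity_criterion T \<longleftrightarrow> cyclicity_criterion (*\<^sub>R) T) \<and>
      (cyclicity_criterion (*\<^sub>R) T \<longleftrightarrow> cyclicity_criterion (*\<^sub>R) S) \<and>
      (cyclicity_criterion (*\<^sub>R) S \<longleftrightarrow> cyclic (prod_smult (*\<^sub>R)) (dsum S)) \<and>
      (cyclic (prod_smult (*\<^sub>R)) (dsum S) \<longleftrightarrow> cyclic (prod_smult (*\<^sub>R)) (dsum T)) \<and>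
      (cyclic (prod_smult (*\<^sub>R)) (dsum T) \<longleftrightarrow> hypercyclic (dsum T)))
   \<and>
   (\<forall>(cs::complex \<Rightarrow> 'b::banach \<Rightarrow> 'b) T S (lam::complex).
      complex_scalar_mult cs \<and>
      separable_space TYPE('b) \<and> infinite_dimensional cs \<and>
      bop cs T \<and> bop cs S \<and> (\<forall>x. T x = cs lam x + S x) \<and> hypercyclic T \<longrightarrow>
      (hypercyclicity_criterion T \<longleftrightarrow> cyclicity_criterion cs T) \<and>
      (cyclicity_criterion cs T \<longleftrightarrow> cyclicity_criterion cs S) \<and>
      (cyclicity_criterion cs S \<longleftrightarrow> cyclic (prod_smult cs) (dsum S)) \<and>
      (cyclic (prod_smult cs) (dsum S) \<longleftrightarrow> cyclic (prod_smult cs) (dsum T)) \<and>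
      (cyclic (prod_smult cs) (dsum T) \<longleftrightarrow> hypercyclic (dsum T)))"
proof (rule conjI; intro allI impI; elim conjE)
  fix T S :: "'a \<Rightarrow> 'a" and lam
  assume *: "separable_space TYPE('a)" "infinite_dimensional ((*\<^sub>R) :: real \<Rightarrow> 'a \<Rightarrow> 'a)"
    "bop (*\<^sub>R) T" "bop (*\<^sub>R) S" "\<forall>x. T x = lam *\<^sub>R x + S x" "hypercyclic T"
  show "(hypercyclicity_criterion T \<longleftrightarrow> cyclicity_criterion (*\<^sub>R) T) \<and>
      (cyclicity_criterion (*\<^sub>R) T \<longleftrightarrow> cyclicity_criterion (*\<^sub>R) S) \<and>
      (cyclicity_criterion (*\<^sub>R) S \<longleftrightarrow> cyclic (prod_smult (*\<^sub>R)) (dsum S)) \<and>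
      (cyclic (prod_smult (*\<^sub>R)) (dsum S) \<longleftrightarrow> cyclic (prod_smult (*\<^sub>R)) (dsum T)) \<and>
      (cyclic (prod_smult (*\<^sub>R)) (dsum T) \<longleftrightarrow> hypercyclic (dsum T))"
    by (rule continuous_scalars.hypercyclic_criteria_equivalent
        [OF continuous_scalars_real *(1-4) spec[OF *(5)] *(6)])
next
  fix cs :: "complex \<Rightarrow> 'b \<Rightarrow> 'b" and T S lam
  assume *: "complex_scalar_mult cs" "separable_space TYPE('b)" "infinite_dimensional cs"
    "bop cs T" "bop cs S" "\<forall>x. T x = cs lam x + S x" "hypercyclic T"
  show "(hypercyclicity_criterion T \<longleftrightarrow> cyclicity_criterion cs T) \<and>
      (cyclicity_criterion cs T \<longleftrightarrow> cyclicity_criterion cs S) \<and>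
      (cyclicity_criterion cs S \<longleftrightarrow> cyclic (prod_smult cs) (dsum S)) \<and>
      (cyclic (prod_smult cs) (dsum S) \<longleftrightarrow> cyclic (prod_smult cs) (dsum T)) \<and>
      (cyclic (prod_smult cs) (dsum T) \<longleftrightarrow> hypercyclic (dsum T))"
    by (rule continuous_scalars.hypercyclic_criteria_equivalent
        [OF continuous_scalars_complex[OF *(1)] *(2-5) spec[OF *(6)] *(7)])
qed

end
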